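(* Let $p$ be a prime number and let $T_{2p}\langle 2,p\rangle$ be the Toeplitz graph on $\{1,\dots,2p\}$ with generating set $\{2,p\}$. Then $$\frac{2p}{2p-1}\leq \mathrm{ldim}_{\mathrm{f}}(T_{2p}\langle 2,p\rangle)\leq \frac{2p}{2p-2}=\frac{p}{p-1}.$$
   Context: For a positive integer $n$ and $S\subseteq\{1,\dots,n\}$, the Toeplitz graph $T_n\langle S\rangle$ has vertex set $\{1,2,\dots,n\}$, and distinct vertices $p,q$ are adjacent iff $|p-q|\in S$. For a finite simple graph $G$ with shortest-path distance $d$ (taken to be $\infty$ between different components), and vertices $v,w$, the resolving neighborhood is $\mathcal{R}\{v,w\}=\{u\in V(G): d(u,v)\neq d(u,w)\}$. A local resolving function of $G$ is a map $\zeta:V(G)\to[0,1]$ such that $\sum_{u\in\mathcal{R}\{v,w\}}\zeta(u)\geq 1$ for every edge $vw$ of $G$. The local fractional metric dimension is $\mathrm{ldim}_{\mathrm{f}}(G)=\min\{\sum_{v\in V(G)}\zeta(v): \zeta \text{ a local resolving function of } G\}$. *)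

theory Defs
  imports "HOL-Analysis.Analysis" "HOL-Library.Extended_Nat" "HOL-Computational_Algebra.Primes"
begin

text \<open>
  A finite simple graph is given by a finite vertex set \<open>V\<close> and its adjacency relation \<open>E\<close>,
  a symmetric irreflexive subset of \<open>V \<times> V\<close>.
\<close>

definition simple_graph :: "'a set \<Rightarrow> ('a \<times> 'a) set \<Rightarrow> bool" where
  "simple_graph V E \<longleftrightarrow> finite V \<and> E \<subseteq> V \<times> V \<and> sym E \<and> irrefl E"

text \<open>
  \<open>(u, v) \<in> E ^^ k\<close> says that there is a walk with \<open>k\<close> edges from \<open>u\<close> to \<open>v\<close>; for vertices
  in different components the infimum of the empty set gives \<open>\<infinity>\<close>.
\<close>

definition graph_dist :: "('a \<times> 'a) set \<Rightarrow> 'a \<Rightarrow> 'a \<Rightarrow> enat" where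
  "graph_dist E u v = Inf {enat k | k. (u, v) \<in> E ^^ k}"

definition resolving_nbhd :: "'a set \<Rightarrow> ('a \<times> 'a) set \<Rightarrow> 'a \<Rightarrow> 'a \<Rightarrow> 'a set" where
  "resolving_nbhd V E v w = {u \<in> V. graph_dist E u v \<noteq> graph_dist E u w}"

definition local_resolving_function :: "'a set \<Rightarrow> ('a \<times> 'a) set \<Rightarrow> ('a \<Rightarrow> real) \<Rightarrow> bool" where
  "local_resolving_function V E \<zeta> \<longleftrightarrow>
     \<zeta> \<in> V \<rightarrow> {0..1} \<and> (\<forall>(v, w) \<in> E. (\<Sum>u \<in> resolving_nbhd V E v w. \<zeta> u) \<ge> 1)"

text \<open>The least element is attained for every finite simple graph, see \<open>ldimf_attained\<close> below.\<close>

definition ldimf :: "'a set \<Rightarrow> ('a \<times> 'a) set \<Rightarrow> real" where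
  "ldimf V E = (LEAST x. \<exists>\<zeta>. local_resolving_function V E \<zeta> \<and> x = (\<Sum>v \<in> V. \<zeta> v))"

definition toeplitz_vertices :: "nat \<Rightarrow> nat set" where
  "toeplitz_vertices n = {1..n}"

definition toeplitz_edges :: "nat \<Rightarrow> nat set \<Rightarrow> (nat \<times> nat) set" where
  "toeplitz_edges n S =
     {(x, y). x \<in> {1..n} \<and> y \<in> {1..n} \<and> x \<noteq> y \<and> nat \<bar>int x - int y\<bar> \<in> S}"

lemma simple_graph_toeplitz: "simple_graph (toeplitz_vertices n) (toeplitz_edges n S)"
  by (auto simp: simple_graph_def toeplitz_vertices_def toeplitz_edges_def sym_def irrefl_def
      abs_minus_commute)

lemma graph_dist_refl: "graph_dist E u u = 0"
proof -
  have "enat 0 \<in> {enat k | k. (u, u) \<in> E ^^ k}"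
    by (intro CollectI exI[of _ 0]) simp
  then have "graph_dist E u u \<le> enat 0"
    unfolding graph_dist_def by (rule Inf_lower)
  then show ?thesis
    by (simp add: zero_enat_def[symmetric])
qed

lemma graph_dist_neq_0:
  assumes "u \<noteq> v"
  shows "graph_dist E u v \<noteq> 0"
proof -
  have "1 \<le> graph_dist E u v"
    unfolding graph_dist_def
  proof (rule Inf_greatest)
    fix x assume "x \<in> {enat k | k. (u, v) \<in> E ^^ k}"
    then obtain k where k: "x = enat k" "(u, v) \<in> E ^^ k" by auto
    then have "k \<noteq> 0" using assms by (cases k) auto
    then show "1 \<le> x" using k by (simp add: one_enat_def)
  qed
  then show ?thesis by auto
qed

lemma local_resolving_function_one:
  assumes "simple_graph V E"
  shows "local_resolving_function V E (\<lambda>_. 1)"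
proof -
  have "real (card (resolving_nbhd V E v w)) \<ge> 1" if "(v, w) \<in> E" for v w
  proof -
    have "v \<in> V" "v \<noteq> w" using that assms by (auto simp: simple_graph_def irrefl_def)
    then have "v \<in> resolving_nbhd V E v w"
      using graph_dist_neq_0[of v w E] by (auto simp: resolving_nbhd_def graph_dist_refl)
    moreover have "finite (resolving_nbhd V E v w)"
      using assms by (simp add: simple_graph_def resolving_nbhd_def)
    ultimately have "card (resolving_nbhd V E v w) > 0"
      using card_gt_0_iff by blast
    then show ?thesis by linarith
  qed
  then show ?thesis by (auto simp: local_resolving_function_def)
qed

lemma ldimf_attained:
  assumes G: "simple_graph V E"
  obtains \<zeta> where "local_resolving_function V E \<zeta>" "ldimf V E = (\<Sum>v \<in> V. \<zeta> v)"
    "\<And>\<xi>. local_resolving_function V E \<xi> \<Longrightarrow> (\<Sum>v \<in> V. \<zeta> v) \<le> (\<Sum>v \<in> V. \<xi> v)"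
proof -
  define K :: "('a \<Rightarrow> real) set"
    where "K = PiE UNIV (\<lambda>v. if v \<in> V then {0..1} else {0})"
  define L where "L = (\<Inter>e \<in> E. {\<zeta> :: 'a \<Rightarrow> real. 1 \<le> (\<Sum>u \<in> resolving_nbhd V E (fst e) (snd e). \<zeta> u)})"
  have "compactin (product_topology (\<lambda>_. euclidean) UNIV) K"
    unfolding K_def by (subst compactin_PiE) auto
  then have "compact K"
    by (simp add: euclidean_product_topology)
  have cont: "continuous_on UNIV (\<lambda>\<zeta> :: 'a \<Rightarrow> real. \<Sum>u \<in> A. \<zeta> u)" for A
    by (intro continuous_on_sum continuous_on_product_coordinates)
  have "closed L"
    unfolding L_def by (intro closed_INT ballI closed_Collect_le cont continuous_on_const)
  with \<open>compact K\<close> have "compact (K \<inter> L)" by (rule compact_Int_closed)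
  have feas: "local_resolving_function V E \<zeta>" if "\<zeta> \<in> K \<inter> L" for \<zeta>
    using that by (fastforce simp: K_def L_def local_resolving_function_def PiE_iff split: if_splits)
  have cut: "(\<lambda>v. if v \<in> V then \<xi> v else 0) \<in> K \<inter> L" if "local_resolving_function V E \<xi>" for \<xi>
  proof -
    have "(\<Sum>u \<in> resolving_nbhd V E v w. if u \<in> V then \<xi> u else 0)
        = (\<Sum>u \<in> resolving_nbhd V E v w. \<xi> u)" for v w
      by (intro sum.cong) (auto simp: resolving_nbhd_def)
    then show ?thesis
      using that by (auto simp: K_def L_def local_resolving_function_def)
  qed
  have "K \<inter> L \<noteq> {}"
    using cut[OF local_resolving_function_one[OF G]] by blast
  then obtain \<zeta> where \<zeta>: "\<zeta> \<in> K \<inter> L" "\<And>\<xi>. \<xi> \<in> K \<inter> L \<Longrightarrow> (\<Sum>v \<in> V. \<zeta> v) \<le> (\<Sum>v \<in> V. \<xi> v)"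
    using continuous_attains_inf[OF \<open>compact (K \<inter> L)\<close>, of "\<lambda>\<zeta>. \<Sum>v \<in> V. \<zeta> v"]
      continuous_on_subset[OF cont] by blast
  have le: "(\<Sum>v \<in> V. \<zeta> v) \<le> (\<Sum>v \<in> V. \<xi> v)" if "local_resolving_function V E \<xi>" for \<xi>
  proof -
    have "(\<Sum>v \<in> V. \<zeta> v) \<le> (\<Sum>v \<in> V. if v \<in> V then \<xi> v else 0)"
      using \<zeta>(2)[OF cut[OF that]] .
    also have "\<dots> = (\<Sum>v \<in> V. \<xi> v)" by (intro sum.cong) auto
    finally show ?thesis .
  qed
  have eq: "ldimf V E = (\<Sum>v \<in> V. \<zeta> v)"
    unfolding ldimf_def by (rule Least_equality) (use feas[OF \<zeta>(1)] le in auto)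
  show thesis by (rule that[OF feas[OF \<zeta>(1)] eq le])
qed

end

theory Submission
  imports Defs
begin

text \<open>
  For odd \<open>p\<close> the graph is connected and the distance of two vertices depends only on their
  difference. From the explicit distance, an edge \<open>{v, v + 2}\<close> is unresolved at most by \<open>v + 1\<close> and
  one of \<open>v + p + 3\<close>, \<open>v - p - 1\<close>, and an edge \<open>{v, v + p}\<close> at most by \<open>v - 1\<close> and \<open>v + p + 1\<close>.
  So every edge is resolved by at least \<open>2p - 2\<close> vertices and the constant function
  \<open>1 / (2p - 2)\<close> gives the upper bound. Conversely every vertex \<open>u\<close> leaves some edge unresolved
  (\<open>{u - 1, u + 1}\<close> unless \<open>u\<close> is \<open>1\<close> or \<open>2p\<close>), and adding up these \<open>2p\<close> constraints gives the lower
  bound. For \<open>p = 2\<close> the graph consists of two disjoint edges.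
\<close>

section \<open>General criteria for distances and for the dimension\<close>

text \<open>By \<open>Lipschitz\<close>, each edge given by \<open>descent\<close> lowers
  \<open>g\<close> by exactly 1, so descending from \<open>v\<close> traces a walk of length
  \<open>g v\<close>. \<open>Lipschitz\<close> also bounds \<open>g\<close> along every walk from
  \<open>u\<close>, so no walk is shorter.\<close>

lemma graph_dist_eqI:
  fixes g :: "'a \<Rightarrow> nat"
  assumes "E \<subseteq> V \<times> V" "v \<in> V" "g u = 0"
    and Lipschitz: "\<And>x y. (x, y) \<in> E \<Longrightarrow> g y \<le> g x + 1"
    and descent: "\<And>y. y \<in> V \<Longrightarrow> y \<noteq> u \<Longrightarrow> \<exists>x. (x, y) \<in> E \<and> g x < g y"
  shows "graph_dist E u v = enat (g v)"
proof (rule antisym)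
  have "(u, v) \<in> E ^^ g v"
    using \<open>v \<in> V\<close>
  proof (induction "g v" arbitrary: v rule: less_induct)
    case less
    show ?case
    proof (cases "v = u")
      case False
      then obtain x where x: "(x, v) \<in> E" "g x < g v"
        using descent less.prems by blast
      then have "(u, x) \<in> E ^^ g x"
        using less.hyps \<open>E \<subseteq> V \<times> V\<close> by blast
      moreover have "g v = Suc (g x)"
        using Lipschitz[OF x(1)] x(2) by simp
      ultimately show ?thesis
        using x(1) by auto
    qed (simp add: \<open>g u = 0\<close>)
  qed
  then show "graph_dist E u v \<le> enat (g v)"
    unfolding graph_dist_def by (blast intro: Inf_lower)
  have "g y \<le> k" if "(u, y) \<in> E ^^ k" for k y
    using that
  proof (induction k arbitrary: y)
    case (Suc k)
    then show ?case
      using Lipschitz by fastforce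
  qed (simp add: \<open>g u = 0\<close>)
  then show "enat (g v) \<le> graph_dist E u v"
    unfolding graph_dist_def by (auto intro!: Inf_greatest)
qed

text \<open>The constant function \<open>1 / k\<close> is feasible, and its total weight is the
  stated bound.\<close>

lemma ldimf_le_card_div:
  assumes G: "simple_graph V E" and "k > 0"
    and large: "\<And>v w. (v, w) \<in> E \<Longrightarrow> k \<le> card (resolving_nbhd V E v w)"
  shows "ldimf V E \<le> real (card V) / real k"
proof -
  have "local_resolving_function V E (\<lambda>_. 1 / real k)"
    using large \<open>k > 0\<close> by (auto simp: local_resolving_function_def field_simps)
  then show ?thesis
    using ldimf_attained[OF G] by (metis sum_constant times_divide_eq_right mult.right_neutral)
qed

text \<open>Sum the constraint of an edge unresolved by \<open>u\<close> over all \<open>u\<close>.\<close>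

lemma card_div_le_ldimf:
  assumes G: "simple_graph V E" and "card V > 1"
    and unresolved: "\<And>u. u \<in> V \<Longrightarrow> \<exists>(v, w) \<in> E. graph_dist E u v = graph_dist E u w"
  shows "real (card V) / (real (card V) - 1) \<le> ldimf V E"
proof -
  obtain \<zeta> where \<zeta>: "local_resolving_function V E \<zeta>" "ldimf V E = (\<Sum>v \<in> V. \<zeta> v)"
    using ldimf_attained[OF G] by metis
  have fin: "finite V" using G by (simp add: simple_graph_def)
  have "1 \<le> ldimf V E - \<zeta> u" if u: "u \<in> V" for u
  proof -
    obtain v w where e: "(v, w) \<in> E" "graph_dist E u v = graph_dist E u w"
      using unresolved[OF u] by blast
    have "1 \<le> (\<Sum>x \<in> resolving_nbhd V E v w. \<zeta> x)"
      using \<zeta>(1) e(1) by (auto simp: local_resolving_function_def)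
    \<comment> \<open>The vertex \<open>u\<close> does not resolve the chosen edge, so leaving it
      out of \<open>V\<close> loses nothing; the terms added are nonnegative.\<close>
    also have "\<dots> \<le> (\<Sum>x \<in> V - {u}. \<zeta> x)"
      using \<zeta>(1) e(2) fin
      by (intro sum_mono2) (auto simp: resolving_nbhd_def local_resolving_function_def)
    finally show ?thesis
      using u fin by (simp add: \<zeta>(2) sum_diff1)
  qed
  then have "(\<Sum>u \<in> V. 1) \<le> (\<Sum>u \<in> V. ldimf V E - \<zeta> u)"
    by (intro sum_mono) auto
  then have "real (card V) \<le> (real (card V) - 1) * ldimf V E"
    by (simp add: sum_subtractf \<zeta>(2)[symmetric] algebra_simps)
  then show ?thesis
    using \<open>card V > 1\<close> by (simp add: field_simps)
qed

section \<open>The explicit distance and its change along an edge\<close>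

text \<open>
  A walk whose steps have net displacement \<open>2a + pb\<close> has at least \<open>\<bar>a\<bar> + \<bar>b\<bar>\<close> edges; for
  displacement \<open>d\<close> the optimal \<open>b\<close> is \<open>0\<close> or \<open>\<plusminus>2\<close> if \<open>d\<close> is even, and \<open>\<plusminus>1\<close> if \<open>d\<close> is odd.
\<close>

definition toeplitz_dist :: "int \<Rightarrow> int \<Rightarrow> int" where
  "toeplitz_dist p d = (if even d then min (\<bar>d\<bar> div 2) (p + 2 - \<bar>d\<bar> div 2)
     else 1 + \<bar>\<bar>d\<bar> - p\<bar> div 2)"

lemma toeplitz_dist_minus [simp]: "toeplitz_dist p (- d) = toeplitz_dist p d"
  by (simp add: toeplitz_dist_def)

lemma toeplitz_dist_nonneg: "\<bar>d\<bar> < 2 * p \<Longrightarrow> 0 \<le> toeplitz_dist p d"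
  by (auto simp: toeplitz_dist_def)

lemma toeplitz_dist_even: "toeplitz_dist p (2 * j) = min \<bar>j\<bar> (p + 2 - \<bar>j\<bar>)"
proof -
  have "\<bar>2 * j\<bar> div 2 = \<bar>j\<bar>" by linarith
  then show ?thesis by (simp add: toeplitz_dist_def)
qed

lemma toeplitz_dist_odd:
  "toeplitz_dist (2 * m + 1) (2 * j + 1) = 1 + (if 0 \<le> j then \<bar>j - m\<bar> else \<bar>j + 1 + m\<bar>)"
proof -
  have "\<bar>\<bar>2 * j + 1\<bar> - (2 * m + 1)\<bar> div 2 = (if 0 \<le> j then \<bar>j - m\<bar> else \<bar>j + 1 + m\<bar>)"
    by (auto simp: abs_if)
  then show ?thesis by (simp add: toeplitz_dist_def)
qed

text \<open>On each parity class the function is piecewise linear with slope 1 or -1 in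
  \<open>j\<close>. A tie needs a step that straddles a fold: the two odd branches meet between -1
  and 1, and the two terms of the minimum cross at \<open>p + 2\<close> and
  \<open>- p - 2\<close>.\<close>

lemma toeplitz_dist_add_2:
  assumes "odd p" "3 \<le> p" "\<bar>d\<bar> < 2 * p" "\<bar>d + 2\<bar> < 2 * p"
  shows "toeplitz_dist p (d + 2) \<le> toeplitz_dist p d + 1"
    and "toeplitz_dist p d \<le> toeplitz_dist p (d + 2) + 1"
    and "toeplitz_dist p (d + 2) = toeplitz_dist p d \<Longrightarrow> d = -1 \<or> d = p + 1 \<or> d = - p - 3"
proof -
  obtain m where p: "p = 2 * m + 1" using \<open>odd p\<close> by (elim oddE)
  have "toeplitz_dist p (d + 2) \<le> toeplitz_dist p d + 1 \<and>
    toeplitz_dist p d \<le> toeplitz_dist p (d + 2) + 1 \<and>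
    (toeplitz_dist p (d + 2) = toeplitz_dist p d \<longrightarrow> d = -1 \<or> d = p + 1 \<or> d = - p - 3)"
  proof (cases "even d")
    case True
    then obtain j where "d = 2 * j" by (elim evenE)
    moreover have "2 * j + 2 = 2 * (j + 1)" by simp
    ultimately show ?thesis
      using assms unfolding p by (simp only: toeplitz_dist_even) arith
  next
    case False
    then obtain j where "d = 2 * j + 1" by (elim oddE)
    moreover have "2 * j + 1 + 2 = 2 * (j + 1) + 1" by simp
    ultimately show ?thesis
      using assms unfolding p by (simp only: toeplitz_dist_odd) (simp split: if_splits, arith)
  qed
  then show "toeplitz_dist p (d + 2) \<le> toeplitz_dist p d + 1"
    and "toeplitz_dist p d \<le> toeplitz_dist p (d + 2) + 1"
    and "toeplitz_dist p (d + 2) = toeplitz_dist p d \<Longrightarrow> d = -1 \<or> d = p + 1 \<or> d = - p - 3"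
    by blast+
qed

text \<open>As \<open>p\<close> is odd, the step switches between the even and the odd formula. The
  two ties are exchanged by the symmetry taking \<open>d\<close> to \<open>- d - p\<close>.\<close>

lemma toeplitz_dist_add_p:
  assumes "odd p" "3 \<le> p" "\<bar>d\<bar> < 2 * p" "\<bar>d + p\<bar> < 2 * p"
  shows "toeplitz_dist p (d + p) \<le> toeplitz_dist p d + 1"
    and "toeplitz_dist p d \<le> toeplitz_dist p (d + p) + 1"
    and "toeplitz_dist p (d + p) = toeplitz_dist p d \<Longrightarrow> d = 1 \<or> d = - p - 1"
proof -
  obtain m where p: "p = 2 * m + 1" using \<open>odd p\<close> by (elim oddE)
  have "toeplitz_dist p (d + p) \<le> toeplitz_dist p d + 1 \<and>
    toeplitz_dist p d \<le> toeplitz_dist p (d + p) + 1 \<and>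
    (toeplitz_dist p (d + p) = toeplitz_dist p d \<longrightarrow> d = 1 \<or> d = - p - 1)"
  proof (cases "even d")
    case True
    then obtain j where "d = 2 * j" by (elim evenE)
    moreover have "2 * j + (2 * m + 1) = 2 * (j + m) + 1" by simp
    ultimately show ?thesis
      using assms unfolding p
      by (simp only: toeplitz_dist_even toeplitz_dist_odd) (simp split: if_splits, arith)
  next
    case False
    then obtain j where "d = 2 * j + 1" by (elim oddE)
    moreover have "2 * j + 1 + (2 * m + 1) = 2 * (j + m + 1)" by simp
    ultimately show ?thesis
      using assms unfolding p
      by (simp only: toeplitz_dist_even toeplitz_dist_odd) (simp split: if_splits, arith)
  qed
  then show "toeplitz_dist p (d + p) \<le> toeplitz_dist p d + 1"
    and "toeplitz_dist p d \<le> toeplitz_dist p (d + p) + 1"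
    and "toeplitz_dist p (d + p) = toeplitz_dist p d \<Longrightarrow> d = 1 \<or> d = - p - 1"
    by blast+
qed

section \<open>Descent to a closer neighbor and the distance formula\<close>

lemma toeplitz_dist_descent_up:
  assumes "odd p" "3 \<le> p" "1 \<le> u" "u < y" "y \<le> 2 * p"
  shows "\<exists>x \<in> {y - 2, y + 2, y - p}. 1 \<le> x \<and> x \<le> 2 * p \<and>
    toeplitz_dist p (x - u) < toeplitz_dist p (y - u)"
proof -
  obtain m where p: "p = 2 * m + 1" using \<open>odd p\<close> by (elim oddE)
  show ?thesis
  proof (cases "even (y - u)")
    case True
    then obtain j where j: "y - u = 2 * j" by (elim evenE)
    have *: "y - 2 - u = 2 * (j - 1)" "y - p - u = 2 * (j - m - 1) + 1"
      using j p by auto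
    have "0 < j" "j \<le> 2 * m" using assms j p by linarith+
    show ?thesis
    \<comment> \<open>Up to \<open>m + 1\<close> the minimum is \<open>j\<close>, attained by steps
      of 2 alone; beyond it, using two steps of \<open>p\<close> is shorter.\<close>
    proof (cases "j \<le> m + 1")
      case True
      then have "toeplitz_dist p (y - 2 - u) < toeplitz_dist p (y - u)"
        using \<open>0 < j\<close> unfolding * j unfolding toeplitz_dist_even p by linarith
      moreover have "1 \<le> y - 2" using assms j \<open>0 < j\<close> by linarith
      ultimately show ?thesis using assms by auto
    next
      case False
      then have "toeplitz_dist p (y - p - u) < toeplitz_dist p (y - u)"
        using \<open>j \<le> 2 * m\<close> unfolding * j unfolding toeplitz_dist_even p toeplitz_dist_odd by simp
      moreover have "1 \<le> y - p" using assms False j p by linarith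
      ultimately show ?thesis using assms by auto
    qed
  next
    case False
    then obtain j where j: "y - u = 2 * j + 1" by (elim oddE)
    have *: "y - 2 - u = 2 * (j - 1) + 1" "y + 2 - u = 2 * (j + 1) + 1" "y - p - u = 2 * (j - m)"
      using j p by auto
    have "0 \<le> j" "1 \<le> m" using assms j p by linarith+
    \<comment> \<open>A shortest walk uses one step of \<open>p\<close>. If the difference exceeds
      \<open>p\<close>, first go back by 2; otherwise take the step of \<open>p\<close>. If
      \<open>y - p\<close> is not a vertex, going up by 2 brings the difference closer to
      \<open>p\<close>.\<close>
    consider "j > m" | "j \<le> m" "y > p" | "j < m" "y \<le> p"
      using assms j p by linarith
    then show ?thesis
    proof cases
      case 1
      then have "toeplitz_dist p (y - 2 - u) < toeplitz_dist p (y - u)"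
        using \<open>1 \<le> m\<close> unfolding * j unfolding toeplitz_dist_even p toeplitz_dist_odd by simp
      moreover have "1 \<le> y - 2" using 1 assms j p by linarith
      ultimately show ?thesis using assms by auto
    next
      case 2
      then have "toeplitz_dist p (y - p - u) < toeplitz_dist p (y - u)"
        using \<open>0 \<le> j\<close> unfolding * j unfolding toeplitz_dist_even p toeplitz_dist_odd by simp
      then show ?thesis using assms 2 by auto
    next
      case 3
      then have "toeplitz_dist p (y + 2 - u) < toeplitz_dist p (y - u)"
        using \<open>0 \<le> j\<close> unfolding * j unfolding toeplitz_dist_even p toeplitz_dist_odd by simp
      then show ?thesis using assms 3 by auto
    qed
  qed
qed

text \<open>The case \<open>y < u\<close> follows by the reflection sending \<open>x\<close> to
  \<open>2 * p + 1 - x\<close>, which preserves the vertex range and negates differences.\<close>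

lemma toeplitz_dist_descent:
  assumes "odd p" "3 \<le> p" "1 \<le> u" "u \<le> 2 * p" "1 \<le> y" "y \<le> 2 * p" "y \<noteq> u"
  shows "\<exists>x \<in> {y - 2, y + 2, y - p, y + p}. 1 \<le> x \<and> x \<le> 2 * p \<and>
    toeplitz_dist p (x - u) < toeplitz_dist p (y - u)"
proof (cases "u < y")
  case True
  then show ?thesis
    using toeplitz_dist_descent_up[of p u y] assms by auto
next
  case False
  have refl: "toeplitz_dist p (2 * p + 1 - x - (2 * p + 1 - u)) = toeplitz_dist p (x - u)" for x
    using toeplitz_dist_minus[of p "x - u"] by (simp add: algebra_simps)
  have "\<exists>x \<in> {(2 * p + 1 - y) - 2, (2 * p + 1 - y) + 2, (2 * p + 1 - y) - p}. 1 \<le> x \<and> x \<le> 2 * p \<and>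
      toeplitz_dist p (x - (2 * p + 1 - u)) < toeplitz_dist p (2 * p + 1 - y - (2 * p + 1 - u))"
    by (rule toeplitz_dist_descent_up) (use assms False in auto)
  then obtain x where x: "x \<in> {(2 * p + 1 - y) - 2, (2 * p + 1 - y) + 2, (2 * p + 1 - y) - p}"
    "1 \<le> x" "x \<le> 2 * p"
    "toeplitz_dist p (x - (2 * p + 1 - u)) < toeplitz_dist p (2 * p + 1 - y - (2 * p + 1 - u))"
    by blast
  show ?thesis
    by (rule bexI[of _ "2 * p + 1 - x"])
      (use x refl[of y] refl[of "2 * p + 1 - x"] in \<open>auto simp: algebra_simps\<close>)
qed

lemma toeplitz_edges_iff:
  "(x, y) \<in> toeplitz_edges (2 * p) {2, p} \<longleftrightarrow> x \<in> {1..2 * p} \<and> y \<in> {1..2 * p} \<and> x \<noteq> y \<and>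
    (y = x + 2 \<or> x = y + 2 \<or> y = x + p \<or> x = y + p)"
  unfolding toeplitz_edges_def by auto

text \<open>The step lemmas and the descent are the hypotheses of \<open>graph_dist_eqI\<close>.
  Truncation by \<open>nat\<close> is harmless because differences of vertices are below
  \<open>2 * p\<close> in absolute value.\<close>

lemma graph_dist_toeplitz:
  assumes "odd p" "3 \<le> p" "u \<in> {1..2 * p}" "v \<in> {1..2 * p}"
  shows "graph_dist (toeplitz_edges (2 * p) {2, p}) u v =
    enat (nat (toeplitz_dist (int p) (int v - int u)))"
proof (rule graph_dist_eqI[where V = "{1..2 * p}"])
  show "toeplitz_edges (2 * p) {2, p} \<subseteq> {1..2 * p} \<times> {1..2 * p}"
    by (auto simp: toeplitz_edges_def)
  show "nat (toeplitz_dist (int p) (int u - int u)) = 0"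
    by (simp add: toeplitz_dist_def)
next
  fix x y assume xy: "(x, y) \<in> toeplitz_edges (2 * p) {2, p}"
  have "toeplitz_dist p (int y - int u) \<le> toeplitz_dist p (int x - int u) + 1"
    using xy assms toeplitz_dist_add_2(1)[of p "int x - int u"] toeplitz_dist_add_2(2)[of p "int y - int u"]
      toeplitz_dist_add_p(1)[of p "int x - int u"] toeplitz_dist_add_p(2)[of p "int y - int u"]
    unfolding toeplitz_edges_iff by (auto simp: algebra_simps)
  moreover have "0 \<le> toeplitz_dist p (int x - int u)"
    using xy assms unfolding toeplitz_edges_iff by (intro toeplitz_dist_nonneg) auto
  ultimately show "nat (toeplitz_dist (int p) (int y - int u)) \<le>
      nat (toeplitz_dist (int p) (int x - int u)) + 1"
    by linarith
next
  fix y assume y: "y \<in> {1..2 * p}" "y \<noteq> u"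
  have "\<exists>x \<in> {int y - 2, int y + 2, int y - int p, int y + int p}. 1 \<le> x \<and> x \<le> 2 * int p \<and>
      toeplitz_dist p (x - int u) < toeplitz_dist p (int y - int u)"
    by (rule toeplitz_dist_descent) (use y assms in auto)
  then obtain x where x: "x \<in> {int y - 2, int y + 2, int y - int p, int y + int p}"
    "1 \<le> x" "x \<le> 2 * int p" "toeplitz_dist p (x - int u) < toeplitz_dist p (int y - int u)"
    by blast
  have "(nat x, y) \<in> toeplitz_edges (2 * p) {2, p}"
    using x y assms unfolding toeplitz_edges_iff by auto
  moreover have "0 \<le> toeplitz_dist p (x - int u)"
    using x assms by (intro toeplitz_dist_nonneg) auto
  ultimately show "\<exists>x. (x, y) \<in> toeplitz_edges (2 * p) {2, p} \<and>
      nat (toeplitz_dist p (int x - int u)) < nat (toeplitz_dist p (int y - int u))"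
    using x by (intro exI[of _ "nat x"]) auto
qed (use assms in auto)

lemma graph_dist_toeplitz_eq_iff:
  assumes "odd p" "3 \<le> p" "u \<in> {1..2 * p}" "v \<in> {1..2 * p}" "w \<in> {1..2 * p}"
  shows "graph_dist (toeplitz_edges (2 * p) {2, p}) u v =
      graph_dist (toeplitz_edges (2 * p) {2, p}) u w \<longleftrightarrow>
    toeplitz_dist (int p) (int v - int u) = toeplitz_dist (int p) (int w - int u)"
proof -
  have "0 \<le> toeplitz_dist p (int v - int u)" "0 \<le> toeplitz_dist p (int w - int u)"
    using assms by (auto intro!: toeplitz_dist_nonneg)
  then show ?thesis
    using assms by (simp add: graph_dist_toeplitz eq_nat_nat_iff)
qed

section \<open>Sizes of resolving neighborhoods for odd \<open>p\<close>\<close>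

lemma resolving_nbhd_commute: "resolving_nbhd V E v w = resolving_nbhd V E w v"
  by (auto simp: resolving_nbhd_def)

lemma card_resolving_nbhd_toeplitz:
  assumes p: "odd p" "3 \<le> p" and e: "(v, w) \<in> toeplitz_edges (2 * p) {2, p}"
  shows "2 * p - 2 \<le> card (resolving_nbhd (toeplitz_vertices (2 * p)) (toeplitz_edges (2 * p) {2, p}) v w)"
  (is "_ \<le> card (?R v w)")
proof -
  \<comment> \<open>Here \<open>a\<close> and \<open>b\<close> may coincide or lie outside the
    vertex set, so truncated subtractions can be inserted for them.\<close>
  have bound: "2 * p - 2 \<le> card (?R v w)" 
    if vw: "v \<in> {1..2 * p}" "w \<in> {1..2 * p}"
      and unresolved: "\<And>u. u \<in> {1..2 * p} \<Longrightarrow>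
        toeplitz_dist p (int v - int u) = toeplitz_dist p (int w - int u) \<Longrightarrow> u = a \<or> u = b"
    for v w a b
  proof -
    have sub: "{1..2 * p} - {a, b} \<subseteq> ?R v w"
      using unresolved graph_dist_toeplitz_eq_iff[OF p _ vw]
      unfolding resolving_nbhd_def toeplitz_vertices_def by blast
    have "2 * p - 2 \<le> card {1..2 * p} - card {a, b}"
      by (auto simp: card_insert_if)
    also have "\<dots> \<le> card ({1..2 * p} - {a, b})"
      by (rule diff_card_le_card_Diff) simp
    also have "\<dots> \<le> card (?R v w)"
      by (rule card_mono[OF _ sub]) (simp add: resolving_nbhd_def toeplitz_vertices_def)
    finally show ?thesis .
  qed
  have up: "2 * p - 2 \<le> card (?R v w)"
    if e: "(v, w) \<in> toeplitz_edges (2 * p) {2, p}" and "v < w" for v w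
  proof -
    have vw: "v \<in> {1..2 * p}" "w \<in> {1..2 * p}" "w = v + 2 \<or> w = v + p"
      using that by (auto simp: toeplitz_edges_iff)
    show ?thesis
      using vw(3)
    proof
      assume w: "w = v + 2"
      \<comment> \<open>The ties allow three values of \<open>u\<close>, but
        \<open>v + p + 3\<close> is a vertex only if \<open>v < p\<close>, and
        \<open>v - p - 1\<close> only if \<open>v > p\<close>.\<close>
      have "u = v + 1 \<or> u = (if v \<le> p then v + p + 3 else v - p - 1)"
        if u: "u \<in> {1..2 * p}"
          "toeplitz_dist p (int v - int u) = toeplitz_dist p (int w - int u)" for u
      proof -
        have "int v - int u = -1 \<or> int v - int u = int p + 1 \<or> int v - int u = - int p - 3"
          by (rule toeplitz_dist_add_2(3)) (use u vw p in \<open>auto simp: w algebra_simps\<close>)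
        then show ?thesis using u vw by auto
      qed
      then show ?thesis
        by (intro bound[of v w "v + 1" "if v \<le> p then v + p + 3 else v - p - 1"] vw) blast
    next
      assume w: "w = v + p"
      have "u = v - 1 \<or> u = v + p + 1"
        if u: "u \<in> {1..2 * p}"
          "toeplitz_dist p (int v - int u) = toeplitz_dist p (int w - int u)" for u
      proof -
        have "int v - int u = 1 \<or> int v - int u = - int p - 1"
          by (rule toeplitz_dist_add_p(3)) (use u vw p in \<open>auto simp: w algebra_simps\<close>)
        then show ?thesis using u vw by auto
      qed
      then show ?thesis
        by (intro bound[of v w "v - 1" "v + p + 1"] vw) blast
    qed
  qed
  have "(w, v) \<in> toeplitz_edges (2 * p) {2, p}" "v \<noteq> w"
    using e by (auto simp: toeplitz_edges_iff)
  then show ?thesis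
    using up[of v w] up[of w v] e by (metis linorder_neqE_nat resolving_nbhd_commute)
qed

section \<open>An unresolved edge for every vertex\<close>

lemma toeplitz_unresolved_edge:
  assumes p: "odd p" "3 \<le> p" and u: "u \<in> {1..2 * p}"
  shows "\<exists>(v, w) \<in> toeplitz_edges (2 * p) {2, p}.
    graph_dist (toeplitz_edges (2 * p) {2, p}) u v = graph_dist (toeplitz_edges (2 * p) {2, p}) u w"
proof -
  obtain m where m: "p = 2 * m + 1" using \<open>odd p\<close> by (elim oddE)
  \<comment> \<open>Both values are \<open>m + 1\<close>. This tie serves the end vertices, which
    lack a neighbor on one side: the edge from 2 to \<open>p + 2\<close> for \<open>u = 1\<close>,
    and its mirror image for \<open>u = 2 * p\<close>.\<close>
  have across: "toeplitz_dist p 1 = toeplitz_dist p (int p + 1)"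
    using p toeplitz_dist_odd[of m 0] toeplitz_dist_even[of p "int m + 1"]
    by (simp add: m algebra_simps)
  have unresolved: ?thesis if "(v, w) \<in> toeplitz_edges (2 * p) {2, p}"
    "toeplitz_dist p (int v - int u) = toeplitz_dist p (int w - int u)" for v w
  proof -
    have "v \<in> {1..2 * p}" "w \<in> {1..2 * p}"
      using that(1) by (auto simp: toeplitz_edges_iff)
    then show ?thesis
      using that graph_dist_toeplitz_eq_iff[OF p u] by blast
  qed
  consider "u = 1" | "u = 2 * p" | "2 \<le> u" "u + 1 \<le> 2 * p"
    using u by fastforce
  then show ?thesis
  proof cases
    case 1
    then show ?thesis
      using p across by (intro unresolved[of 2 "p + 2"]) (auto simp: toeplitz_edges_iff add.commute)
  next
    case 2
    have "toeplitz_dist p (int (2 * p - 1) - int u) = toeplitz_dist p (int (p - 1) - int u)"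
      using 2 p across toeplitz_dist_minus[of p 1] toeplitz_dist_minus[of p "int p + 1"]
      by (simp add: of_nat_diff)
    then show ?thesis
      using 2 p by (intro unresolved[of "2 * p - 1" "p - 1"]) (auto simp: toeplitz_edges_iff)
  next
    case 3
    have "toeplitz_dist p (int (u - 1) - int u) = toeplitz_dist p (int (u + 1) - int u)"
      using 3 toeplitz_dist_minus[of p 1] by (simp add: of_nat_diff)
    then show ?thesis
      using 3 p by (intro unresolved[of "u - 1" "u + 1"]) (auto simp: toeplitz_edges_iff)
  qed
qed

section \<open>The disconnected case \<open>p = 2\<close> and the conclusion\<close>

lemma graph_dist_eq_infinity_if_invariant:
  assumes "\<And>x y. (x, y) \<in> E \<Longrightarrow> f x = f y" "f u \<noteq> f v"
  shows "graph_dist E u v = \<infinity>"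
proof -
  have "f u = f y" if "(u, y) \<in> E ^^ k" for k y
    using that by (induction k arbitrary: y) (use assms(1) in fastforce)+
  then have "{enat k | k. (u, v) \<in> E ^^ k} = {}"
    using assms(2) by blast
  then show ?thesis
    unfolding graph_dist_def by (simp add: top_enat_def)
qed

text \<open>The edge whose ends have the parity opposite to \<open>u\<close> lies in the other
  component, so both its ends are at infinite distance from \<open>u\<close>.\<close>

lemma toeplitz_4_unresolved_edge:
  assumes "u \<in> {1..4}"
  shows "\<exists>(v, w) \<in> toeplitz_edges 4 {2}.
    graph_dist (toeplitz_edges 4 {2}) u v = graph_dist (toeplitz_edges 4 {2}) u w"
proof -
  have inf: "graph_dist (toeplitz_edges 4 {2}) u v = \<infinity>" if "even u \<noteq> even v" for v
    by (rule graph_dist_eq_infinity_if_invariant[where f = even])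
      (use that toeplitz_edges_iff[of _ _ 2] in auto)
  have "(1, 3) \<in> toeplitz_edges 4 {2}" "(2, 4) \<in> toeplitz_edges 4 {2}"
    by (auto simp: toeplitz_edges_def)
  moreover have "graph_dist (toeplitz_edges 4 {2}) u 1 = graph_dist (toeplitz_edges 4 {2}) u 3 \<or>
      graph_dist (toeplitz_edges 4 {2}) u 2 = graph_dist (toeplitz_edges 4 {2}) u 4"
    by (cases "even u") (simp_all add: inf)
  ultimately show ?thesis by blast
qed

text \<open>The ends of an edge always resolve it; for \<open>p = 2\<close> this already is the
  bound \<open>2 * p - 2\<close>.\<close>

lemma two_le_card_resolving_nbhd:
  assumes G: "simple_graph V E" and e: "(v, w) \<in> E"
  shows "2 \<le> card (resolving_nbhd V E v w)"
proof -
  have "v \<noteq> w" "v \<in> V" "w \<in> V" "finite V"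
    using assms by (auto simp: simple_graph_def irrefl_def)
  then have "{v, w} \<subseteq> resolving_nbhd V E v w"
    using graph_dist_neq_0[of v w E] graph_dist_neq_0[of w v E]
    by (auto simp: resolving_nbhd_def graph_dist_refl)
  then have "card {v, w} \<le> card (resolving_nbhd V E v w)"
    by (rule card_mono[rotated]) (simp add: resolving_nbhd_def \<open>finite V\<close>)
  then show ?thesis using \<open>v \<noteq> w\<close> by simp
qed

theorem theorem5:
  fixes p :: nat
  assumes "prime p"
  shows "2 * real p / (2 * real p - 1) \<le> ldimf (toeplitz_vertices (2 * p)) (toeplitz_edges (2 * p) {2, p})
    \<and> ldimf (toeplitz_vertices (2 * p)) (toeplitz_edges (2 * p) {2, p}) \<le> 2 * real p / (2 * real p - 2)
    \<and> 2 * real p / (2 * real p - 2) = real p / (real p - 1)"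
proof -
  let ?V = "toeplitz_vertices (2 * p)" and ?E = "toeplitz_edges (2 * p) {2, p}"
  have "2 \<le> p" using assms by (rule prime_ge_2_nat)
  have card: "card ?V = 2 * p" by (simp add: toeplitz_vertices_def)
  have *: "(\<forall>(v, w) \<in> ?E. 2 * p - 2 \<le> card (resolving_nbhd ?V ?E v w)) \<and>
    (\<forall>u \<in> ?V. \<exists>(v, w) \<in> ?E. graph_dist ?E u v = graph_dist ?E u w)"
  proof (cases "p = 2")
    case True
    then show ?thesis
      using toeplitz_4_unresolved_edge two_le_card_resolving_nbhd[OF simple_graph_toeplitz]
      by (auto simp: toeplitz_vertices_def)
  next
    case False
    then have "odd p" "3 \<le> p"
      using assms \<open>2 \<le> p\<close> prime_odd_nat[of p] by auto
    then show ?thesis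
      using card_resolving_nbhd_toeplitz toeplitz_unresolved_edge
      by (auto simp: toeplitz_vertices_def)
  qed
  have "real (card ?V) / (real (card ?V) - 1) \<le> ldimf ?V ?E"
    using * \<open>2 \<le> p\<close> card by (intro card_div_le_ldimf simple_graph_toeplitz) auto
  moreover have "ldimf ?V ?E \<le> real (card ?V) / real (2 * p - 2)"
    using * \<open>2 \<le> p\<close> by (intro ldimf_le_card_div simple_graph_toeplitz) auto
  ultimately show ?thesis
    using \<open>2 \<le> p\<close> card by (auto simp: of_nat_diff field_simps)
qed

end
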